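(* Let $D$ and $D'$ be $2$-component virtual-link diagrams which represent the same virtual-link. Then any finite sequence of generalized Reidemeister moves between $D$ and $D'$ includes at least $|\mathrm{maxord}(D)-\mathrm{maxord}(D')|/2$ Reidemeister moves of type II (RII-moves).
   Context: A virtual-link diagram is a finite non-empty collection of oriented generic closed curves in $\mathbb R^2$ (immersed circles whose only multiple points are finitely many transverse double points), where each double point is either a real-crossing (equipped with over/under information) or a virtual-crossing (no over/under information). Diagrams are always oriented. Each closed curve is a component; a diagram with two components is a $2$-component virtual-link diagram. Generalized Reidemeister moves are the following local changes of diagrams inside a disk (in both directions, with all possible orientations of the strands), plane isotopies being allowed freely. RI: adding or removing a kink with one real-crossing (of any kind). RII: adding or removing a bigon formed by two strands with two real-crossings, one strand being over at both. RIII: moving one strand across the crossing of two others, where the three strands cross pairwise in three real-crossings, one strand being over both others, one under both others. VRI, VRII, VRIII: the analogues of the underlying planar moves with all crossings involved virtual. VRIV: moving a strand across a real-crossing of two other strands, where the moving strand meets each of the other two in a virtual-crossing. Two diagrams represent the same virtual-link if they are related by a finite sequence of generalized Reidemeister moves. A semi-arc of $D$ is an edge obtained by cutting the curves of $D$ at the real-crossings (both the over- and the under-strand are cut there; virtual-crossings are ignored): its end points are real-crossings and it has no real-crossing in its interior. A component with no real-crossing counts as a single semi-arc. $\mathcal{SA}(D)$ denotes the set of semi-arcs. For a positive integer $n$ write $\mathbb Z_n=\mathbb Z/n\mathbb Z$. An $n$-up-down coloring of $D$ is a map $C:\mathcal{SA}(D)\to\mathbb Z_n$ such that at each real-crossing,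 if $u_1,u_2$ are the under-semi-arcs and $o_1,o_2$ the over-semi-arcs, with the orientation of $D$ pointing from $u_1$ to $u_2$ and from $o_1$ to $o_2$, then $C(u_2)=C(u_1)-1$ and $C(o_2)=C(o_1)+1$. $D$ is $n$-up-down colorable if it has an $n$-up-down coloring. The maximum order of up-down colorings $\mathrm{maxord}(D)$ is the maximum of the positive integers $n$ such that $D$ is $n$-up-down colorable if this maximum is finite, and $0$ otherwise. *)

theory Defs
  imports "HOL-Analysis.Analysis" "HOL-Number_Theory.Cong"
begin

text \<open>
  The source of a diagram with \<open>k\<close> components is the disjoint union of \<open>k\<close> oriented (that is,
  counterclockwise) unit circles, realised as \<open>{..<k} \<times> sphere 0 1\<close>. As \<open>nat\<close> is discrete, the
  product topology is the topology of the disjoint union.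
\<close>

type_synonym plane = "real ^ 2"
type_synonym point = "nat \<times> complex"

text \<open>
  A pair \<open>(p, q)\<close> in \<open>real_crossings\<close> consists of the preimage \<open>p\<close> on the over-strand and the
  preimage \<open>q\<close> on the under-strand of a real-crossing. The remaining double points are the
  virtual-crossings.
\<close>

record diagram =
  ncomps :: nat
  curve :: "point \<Rightarrow> plane"
  real_crossings :: "(point \<times> point) set"

definition source :: "diagram \<Rightarrow> point set" where
  "source D = {..<ncomps D} \<times> sphere 0 1"

definition double_points :: "diagram \<Rightarrow> (point \<times> point) set" where
  "double_points D =
     {(p, q). p \<in> source D \<and> q \<in> source D \<and> p \<noteq> q \<and> curve D p = curve D q}"

definition velocity :: "diagram \<Rightarrow> point \<Rightarrow> plane" where
  "velocity D p = vector_derivative (\<lambda>t. curve D (fst p, snd p * cis t)) (at 0)"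

definition smooth_curve :: "(real \<Rightarrow> plane) \<Rightarrow> bool" where
  "smooth_curve f \<longleftrightarrow>
     (\<exists>d :: nat \<Rightarrow> real \<Rightarrow> plane. d 0 = f \<and>
        (\<forall>n t. (d n has_vector_derivative d (Suc n) t) (at t)))"

definition virtual_link_diagram :: "diagram \<Rightarrow> bool" where
  "virtual_link_diagram D \<longleftrightarrow>
     ncomps D > 0 \<and>
     (\<forall>i < ncomps D. smooth_curve (\<lambda>t. curve D (i, cis t))) \<and>
     (\<forall>p \<in> source D. velocity D p \<noteq> 0) \<and>
     finite (double_points D) \<and>
     (\<forall>p q r. (p, q) \<in> double_points D \<and> (p, r) \<in> double_points D \<longrightarrow> q = r) \<and>
     (\<forall>(p, q) \<in> double_points D. \<not> collinear {0, velocity D p, velocity D q}) \<and>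
     real_crossings D \<subseteq> double_points D \<and>
     (\<forall>p q. (p, q) \<in> real_crossings D \<longrightarrow> (q, p) \<notin> real_crossings D)"


subsection \<open>Up-down colorings\<close>

text \<open>
  Semi-arcs are taken in the source, so that virtual-crossings play no role, and without their
  end points.
\<close>

definition semi_arcs :: "diagram \<Rightarrow> point set set" where
  "semi_arcs D = components (source D - (Domain (real_crossings D) \<union> Range (real_crossings D)))"

definition ends_at :: "point set \<Rightarrow> point \<Rightarrow> bool" where
  "ends_at A p \<longleftrightarrow> (\<forall>\<^sub>F t in at_right 0. (fst p, snd p * cis (- t)) \<in> A)"

definition starts_at :: "point set \<Rightarrow> point \<Rightarrow> bool" where
  "starts_at A p \<longleftrightarrow> (\<forall>\<^sub>F t in at_right 0. (fst p, snd p * cis t) \<in> A)"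

text \<open>The elements of \<open>\<int>/n\<int>\<close> are represented by the integers \<open>0, \<dots>, n - 1\<close>.\<close>

definition up_down_coloring :: "nat \<Rightarrow> diagram \<Rightarrow> (point set \<Rightarrow> int) \<Rightarrow> bool" where
  "up_down_coloring n D C \<longleftrightarrow>
     C \<in> semi_arcs D \<rightarrow> {0..<int n} \<and>
     (\<forall>(p, q) \<in> real_crossings D.
        (\<forall>u1 \<in> semi_arcs D. \<forall>u2 \<in> semi_arcs D.
           ends_at u1 q \<and> starts_at u2 q \<longrightarrow> [C u2 = C u1 - 1] (mod int n)) \<and>
        (\<forall>o1 \<in> semi_arcs D. \<forall>o2 \<in> semi_arcs D.
           ends_at o1 p \<and> starts_at o2 p \<longrightarrow> [C o2 = C o1 + 1] (mod int n)))"

definition up_down_colorable :: "nat \<Rightarrow> diagram \<Rightarrow> bool" where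
  "up_down_colorable n D \<longleftrightarrow> (\<exists>C. up_down_coloring n D C)"

definition maxord :: "diagram \<Rightarrow> nat" where
  "maxord D =
     (if finite {n. n > 0 \<and> up_down_colorable n D}
      then Max {n. n > 0 \<and> up_down_colorable n D} else 0)"


subsection \<open>Plane isotopies\<close>

text \<open>
  Isotopies through homeomorphisms; both ends of an isotopy of diagrams are required to be smooth
  generic diagrams (see \<open>related_by\<close> below).
\<close>

definition plane_isotopy :: "(real \<times> plane \<Rightarrow> plane) \<Rightarrow> bool" where
  "plane_isotopy H \<longleftrightarrow>
     continuous_on ({0..1} \<times> UNIV) H \<and>
     (\<forall>t \<in> {0..1}. \<exists>g. homeomorphism UNIV UNIV (\<lambda>x. H (t, x)) g) \<and>
     (\<forall>x. H (0, x) = x)"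

text \<open>
  Orientation-preserving homeomorphisms of the source, given by a renumbering of the components
  and by lifts \<open>\<theta> i\<close> of the homeomorphisms between the circles.
\<close>

definition reparametrization :: "nat \<Rightarrow> (point \<Rightarrow> point) \<Rightarrow> bool" where
  "reparametrization k \<rho> \<longleftrightarrow>
     (\<exists>\<sigma> \<theta>. bij_betw \<sigma> {..<k} {..<k} \<and>
        (\<forall>i < k. strict_mono (\<theta> i) \<and> continuous_on UNIV (\<theta> i) \<and>
           (\<forall>t. \<theta> i (t + 2 * pi) = \<theta> i t + 2 * pi \<and>
                \<rho> (i, cis t) = (\<sigma> i, cis (\<theta> i t :: real)))))"

text \<open>
  Curves are considered up to orientation-preserving reparametrization; since diagrams are
  parametrized here, a change of parametrization is included in the isotopies.
\<close>

definition isotopic_diagrams :: "diagram \<Rightarrow> diagram \<Rightarrow> bool" where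
  "isotopic_diagrams D D' \<longleftrightarrow>
     ncomps D' = ncomps D \<and>
     (\<exists>H \<rho>. plane_isotopy H \<and> reparametrization (ncomps D) \<rho> \<and>
        (\<forall>p \<in> source D. curve D' (\<rho> p) = H (1, curve D p)) \<and>
        real_crossings D' = map_prod \<rho> \<rho> ` real_crossings D)"


subsection \<open>Local changes inside a disk\<close>

text \<open>The strand \<open>(i, s, e)\<close> is the arc on the \<open>i\<close>-th circle from angle \<open>s\<close> to angle \<open>e\<close>.\<close>

type_synonym strand = "nat \<times> real \<times> real"

definition angles :: "strand \<Rightarrow> real set" where
  "angles = (\<lambda>(i, s, e). {s..e})"

definition inner_angles :: "strand \<Rightarrow> real set" where
  "inner_angles = (\<lambda>(i, s, e). {s<..<e})"

definition point_at :: "strand \<Rightarrow> real \<Rightarrow> point" where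
  "point_at = (\<lambda>(i, s, e) t. (i, cis t))"

definition strands_in :: "plane set \<Rightarrow> strand list \<Rightarrow> diagram \<Rightarrow> bool" where
  "strands_in B as D \<longleftrightarrow>
     (\<forall>(i, s, e) \<in> set as. i < ncomps D \<and> s < e \<and> e < s + 2 * pi) \<and>
     disjoint_family_on (\<lambda>j. point_at (as ! j) ` angles (as ! j)) {..<length as} \<and>
     {p \<in> source D. curve D p \<in> B} = (\<Union>a \<in> set as. point_at a ` angles a) \<and>
     {p \<in> source D. curve D p \<in> interior B} = (\<Union>a \<in> set as. point_at a ` inner_angles a)"

text \<open>
  \<open>D\<close> and \<open>D'\<close> coincide outside the interior of the disk \<open>B\<close>; inside \<open>B\<close> each of them consists
  of the strands \<open>as\<close>, whose end points lie on the boundary of \<open>B\<close>.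
\<close>

definition local_change :: "plane set \<Rightarrow> strand list \<Rightarrow> diagram \<Rightarrow> diagram \<Rightarrow> bool" where
  "local_change B as D D' \<longleftrightarrow>
     ncomps D' = ncomps D \<and>
     B homeomorphic cball (0 :: plane) 1 \<and>
     strands_in B as D \<and> strands_in B as D' \<and>
     (\<forall>p \<in> source D. curve D p \<notin> interior B \<longrightarrow> curve D' p = curve D p) \<and>
     {(p, q) \<in> real_crossings D'. curve D' p \<notin> B} = {(p, q) \<in> real_crossings D. curve D p \<notin> B}"

definition double_points_in :: "plane set \<Rightarrow> diagram \<Rightarrow> (point \<times> point) set" where
  "double_points_in B D = {(p, q) \<in> double_points D. curve D p \<in> B}"

definition real_crossings_in :: "plane set \<Rightarrow> diagram \<Rightarrow> (point \<times> point) set" where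
  "real_crossings_in B D = {(p, q) \<in> real_crossings D. curve D p \<in> B}"

text \<open>
  The three shapes of moves. In each case the combinatorial pattern of the crossings of the strands
  determines the picture in the disk up to a homeomorphism of the disk. The flag \<open>rl\<close> tells
  whether the crossings are real or virtual.
\<close>

definition adds_kink :: "bool \<Rightarrow> diagram \<Rightarrow> diagram \<Rightarrow> bool" where
  "adds_kink rl D D' \<longleftrightarrow>
     (\<exists>B a t u. local_change B [a] D D' \<and>
        t \<in> inner_angles a \<and> u \<in> inner_angles a \<and> t \<noteq> u \<and>
        double_points_in B D = {} \<and>
        double_points_in B D' =
          {(point_at a t, point_at a u), (point_at a u, point_at a t)} \<and>
        real_crossings_in B D' = (if rl then {(point_at a t, point_at a u)} else {}))"

definition adds_bigon :: "bool \<Rightarrow> diagram \<Rightarrow> diagram \<Rightarrow> bool" where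
  "adds_bigon rl D D' \<longleftrightarrow>
     (\<exists>B a b t t' u u'. local_change B [a, b] D D' \<and>
        t \<in> inner_angles a \<and> t' \<in> inner_angles a \<and> t \<noteq> t' \<and>
        u \<in> inner_angles b \<and> u' \<in> inner_angles b \<and> u \<noteq> u' \<and>
        double_points_in B D = {} \<and>
        double_points_in B D' =
          {(point_at a t, point_at b u), (point_at b u, point_at a t),
           (point_at a t', point_at b u'), (point_at b u', point_at a t')} \<and>
        real_crossings_in B D' =
          (if rl then {(point_at a t, point_at b u), (point_at a t', point_at b u')} else {}))"

text \<open>
  Three strands crossing pairwise exactly once; \<open>x j l\<close> is the angle at which strand \<open>j\<close> meets
  strand \<open>l\<close>. The crossing of \<open>j\<close> and \<open>l\<close> is real with \<open>j\<close> over \<open>l\<close> iff \<open>(j, l) \<in> R\<close>.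
\<close>

definition triangle ::
  "(nat \<times> nat) set \<Rightarrow> plane set \<Rightarrow> strand list \<Rightarrow> (nat \<Rightarrow> nat \<Rightarrow> real) \<Rightarrow> diagram \<Rightarrow> bool"
  where
  "triangle R B as x D \<longleftrightarrow>
     (\<forall>j < 3. \<forall>l < 3. j \<noteq> l \<longrightarrow> x j l \<in> inner_angles (as ! j)) \<and>
     double_points_in B D =
       {(point_at (as ! j) (x j l), point_at (as ! l) (x l j)) |j l. j < 3 \<and> l < 3 \<and> j \<noteq> l} \<and>
     real_crossings_in B D =
       {(point_at (as ! j) (x j l), point_at (as ! l) (x l j)) |j l. (j, l) \<in> R}"

text \<open>
  Moving a strand across the crossing of the other two reverses, on each of the three strands, the
  order in which it meets the other two.
\<close>

definition moves_across :: "(nat \<times> nat) set \<Rightarrow> diagram \<Rightarrow> diagram \<Rightarrow> bool" where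
  "moves_across R D D' \<longleftrightarrow>
     (\<exists>B as x x'. length as = 3 \<and> local_change B as D D' \<and>
        triangle R B as x D \<and> triangle R B as x' D' \<and>
        (\<forall>j < 3. \<forall>l < 3. \<forall>m < 3. j \<noteq> l \<and> j \<noteq> m \<and> l \<noteq> m \<longrightarrow>
           (x j l < x j m \<longleftrightarrow> x' j m < x' j l)))"


subsection \<open>Generalized Reidemeister moves\<close>

datatype move = Isotopy | RI | RII | RIII | VRI | VRII | VRIII | VRIV

fun changes :: "move \<Rightarrow> diagram \<Rightarrow> diagram \<Rightarrow> bool" where
  "changes Isotopy = isotopic_diagrams"
| "changes RI = adds_kink True"
| "changes RII = adds_bigon True"
| "changes RIII = moves_across {(0, 1), (0, 2), (1, 2)}"
| "changes VRI = adds_kink False"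
| "changes VRII = adds_bigon False"
| "changes VRIII = moves_across {}"
| "changes VRIV = moves_across {(1, 2)}"

definition related_by :: "move \<Rightarrow> diagram \<Rightarrow> diagram \<Rightarrow> bool" where
  "related_by m D D' \<longleftrightarrow>
     virtual_link_diagram D \<and> virtual_link_diagram D' \<and> (changes m D D' \<or> changes m D' D)"

fun move_sequence :: "diagram \<Rightarrow> move list \<Rightarrow> diagram \<Rightarrow> bool" where
  "move_sequence D [] D' \<longleftrightarrow> D' = D"
| "move_sequence D (m # ms) D' \<longleftrightarrow> (\<exists>E. related_by m D E \<and> move_sequence E ms D')"

definition same_virtual_link :: "diagram \<Rightarrow> diagram \<Rightarrow> bool" where
  "same_virtual_link D D' \<longleftrightarrow> (\<exists>ms. move_sequence D ms D')"

end

theory Submission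
  imports Defs
begin

text \<open>
  Going once around the component \<open>i\<close>, the color changes by the number of over-points minus the
  number of under-points on it, so an \<open>n\<close>-up-down coloring exists iff \<open>n\<close> divides this number,
  the crossing index, for every \<open>i\<close>. Each crossing contributes \<open>1\<close> and \<open>-1\<close>, so the two indices of
  a 2-component diagram are \<open>d\<close> and \<open>-d\<close>, and \<open>maxord D = \<bar>d\<bar>\<close>. A move that is not of type II
  preserves the indices up to renumbering of the components, as it only adds self-crossings or
  rearranges crossings between the same strands; an RII-move changes \<open>d\<close> by at most \<open>2\<close>.
\<close>

section \<open>Crossing weights and crossing indices\<close>

definition crossing_points :: "diagram \<Rightarrow> point set" where
  "crossing_points D = Domain (real_crossings D) \<union> Range (real_crossings D)"

text \<open>The amount that a coloring gains modulo \<open>n\<close> in passing \<open>p\<close>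
  along the orientation. It is total, with value 0 away from the crossings, so that crossing and
  ordinary points can be treated alike.\<close>

definition crossing_weight :: "diagram \<Rightarrow> point \<Rightarrow> int" where
  "crossing_weight D p =
     of_bool (p \<in> Domain (real_crossings D)) - of_bool (p \<in> Range (real_crossings D))"

text \<open>The argument is a set of crossings and not a diagram, so that the crossings inside and
  outside a disk can be evaluated separately.\<close>

definition crossing_index :: "(point \<times> point) set \<Rightarrow> nat \<Rightarrow> int" where
  "crossing_index R i = (\<Sum>(p, q)\<in>R. of_bool (fst p = i) - of_bool (fst q = i))"

section \<open>Angles on the unit circle\<close>

lemma cis_eq_cis_iff: "cis a = cis b \<longleftrightarrow> (\<exists>k::int. a = b + 2 * pi * of_int k)"
  using sin_cos_eq_iff[of a b] by (auto simp: complex_eq_iff)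

lemma cis_Arg_unit: "norm z = 1 \<Longrightarrow> cis (Arg z) = z"
  by (cases "z = 0") (simp_all add: cis_Arg sgn_eq)

text \<open>Two angles of the same point differ by whole turns, and a bounded interval has room for
  only finitely many of them.\<close>

lemma finite_cis_preimage: "finite {u \<in> {a..b}. cis u = z}"
proof (cases "\<exists>u0. cis u0 = z")
  case True
  then obtain u0 where u0: "cis u0 = z" by blast
  have "{u \<in> {a..b}. cis u = z} \<subseteq>
      (\<lambda>k::int. u0 + 2 * pi * of_int k) ` {\<lceil>(a - u0) / (2 * pi)\<rceil>..\<lfloor>(b - u0) / (2 * pi)\<rfloor>}"
  proof
    fix u assume "u \<in> {u \<in> {a..b}. cis u = z}"
    then have u: "a \<le> u" "u \<le> b" "cis u = cis u0" using u0 by auto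
    then obtain k :: int where k: "u = u0 + 2 * pi * of_int k"
      unfolding cis_eq_cis_iff by blast
    have "(a - u0) / (2 * pi) \<le> of_int k" "of_int k \<le> (b - u0) / (2 * pi)"
      using u k by (simp_all add: field_simps)
    then have "k \<in> {\<lceil>(a - u0) / (2 * pi)\<rceil>..\<lfloor>(b - u0) / (2 * pi)\<rfloor>}"
      by (simp add: ceiling_le le_floor_iff)
    then show "u \<in> (\<lambda>k::int. u0 + 2 * pi * of_int k) `
        {\<lceil>(a - u0) / (2 * pi)\<rceil>..\<lfloor>(b - u0) / (2 * pi)\<rfloor>}"
      using k by blast
  qed
  then show ?thesis by (rule finite_subset) simp
next
  case False
  then show ?thesis by (auto intro: finite_subset[of _ "{}"])
qed

lemma bij_betw_cis: "bij_betw cis {a<..a + 2 * pi} (sphere 0 1)"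
proof (rule bij_betwI')
  fix x y assume xy: "x \<in> {a<..a + 2 * pi}" "y \<in> {a<..a + 2 * pi}"
  have "k = 0" if k: "x = y + 2 * pi * of_int k" for k :: int
  proof -
    have "\<bar>2 * pi * of_int k\<bar> < 2 * pi" using xy k by auto
    then have "\<bar>of_int k :: real\<bar> < 1" by (simp add: abs_mult)
    then show ?thesis by linarith
  qed
  then show "(cis x = cis y) \<longleftrightarrow> x = y" unfolding cis_eq_cis_iff by fastforce
next
  fix z :: complex assume "z \<in> sphere 0 1"
  then have z: "cis (Arg z) = z" by (simp add: cis_Arg_unit)
  \<comment> \<open>\<open>k\<close> is the number of turns to take off. Ceiling minus one, rather
    than floor, matches an interval that is open on the left and closed on the right.\<close>
  define k where "k = \<lceil>(Arg z - a) / (2 * pi)\<rceil> - 1"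
  define u where "u = Arg z - 2 * pi * of_int k"
  have "of_int k < (Arg z - a) / (2 * pi)" "(Arg z - a) / (2 * pi) \<le> of_int k + 1"
    unfolding k_def by linarith+
  then have "u \<in> {a<..a + 2 * pi}" by (simp add: u_def field_simps)
  moreover have "cis u = cis (Arg z)"
    unfolding cis_eq_cis_iff u_def by (intro exI[of _ "-k"]) simp
  ultimately show "\<exists>u\<in>{a<..a + 2 * pi}. z = cis u" using z by auto
qed auto

section \<open>Real-crossings as pairs of points of the source\<close>

text \<open>The last three facts say that a point takes part in at most one real-crossing and in one
  role only: a double point has a unique partner, and asymmetry forbids being both over and under
  with it.\<close>

lemma virtual_link_diagramD:
  assumes "virtual_link_diagram D"
  shows "finite (real_crossings D)"
    and "(p, q) \<in> real_crossings D \<Longrightarrow> p \<in> source D \<and> q \<in> source D"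
    and "(p, q) \<in> real_crossings D \<Longrightarrow> (p, r) \<in> real_crossings D \<Longrightarrow> q = r"
    and "(q, p) \<in> real_crossings D \<Longrightarrow> (r, p) \<in> real_crossings D \<Longrightarrow> q = r"
    and "(p, q) \<in> real_crossings D \<Longrightarrow> (r, p) \<notin> real_crossings D"
proof -
  have sub: "real_crossings D \<subseteq> double_points D" and fin: "finite (double_points D)"
    and uniq: "\<And>p q r. (p, q) \<in> double_points D \<Longrightarrow> (p, r) \<in> double_points D \<Longrightarrow> q = r"
    and asym: "\<And>p q. (p, q) \<in> real_crossings D \<Longrightarrow> (q, p) \<notin> real_crossings D"
    using assms unfolding virtual_link_diagram_def by blast+
  have sym: "(q, p) \<in> double_points D" if "(p, q) \<in> double_points D" for p q
    using that by (auto simp: double_points_def)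
  show "finite (real_crossings D)" using sub fin by (rule finite_subset)
  show "(p, q) \<in> real_crossings D \<Longrightarrow> p \<in> source D \<and> q \<in> source D"
    using sub by (auto simp: double_points_def)
  show "(p, q) \<in> real_crossings D \<Longrightarrow> (p, r) \<in> real_crossings D \<Longrightarrow> q = r"
    using sub uniq by blast
  show "(q, p) \<in> real_crossings D \<Longrightarrow> (r, p) \<in> real_crossings D \<Longrightarrow> q = r"
    using sub uniq sym by blast
  show "(p, q) \<in> real_crossings D \<Longrightarrow> (r, p) \<notin> real_crossings D"
    using sub uniq sym asym by blast
qed

lemma finite_crossing_points:
  "virtual_link_diagram D \<Longrightarrow> finite (crossing_points D)"
  by (simp add: crossing_points_def virtual_link_diagramD(1) finite_Domain finite_Range)

lemma crossing_weight_over: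
  assumes "virtual_link_diagram D" "(p, q) \<in> real_crossings D"
  shows "crossing_weight D p = 1"
proof -
  have "p \<in> Domain (real_crossings D)" "p \<notin> Range (real_crossings D)"
    using assms virtual_link_diagramD(5)[OF assms] by (blast, metis RangeE)
  then show ?thesis by (simp add: crossing_weight_def)
qed

lemma crossing_weight_under:
  assumes "virtual_link_diagram D" "(p, q) \<in> real_crossings D"
  shows "crossing_weight D q = -1"
proof -
  have "q \<in> Range (real_crossings D)" "q \<notin> Domain (real_crossings D)"
    using assms virtual_link_diagramD(5)[OF assms(1)] by (blast, metis DomainE)
  then show ?thesis by (simp add: crossing_weight_def)
qed

text \<open>Double counting: both projections are injective on the crossings, so a sum over
  crossings becomes a sum over their over-points and under-points.\<close>

lemma crossing_index_eq_sum_weight: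
  assumes "virtual_link_diagram D"
  shows "crossing_index (real_crossings D) i =
    (\<Sum>p\<in>{p \<in> crossing_points D. fst p = i}. crossing_weight D p)"
proof -
  let ?R = "real_crossings D"
  note D = virtual_link_diagramD[OF assms]
  have fin: "finite (crossing_points D)" using assms by (rule finite_crossing_points)
  have "inj_on fst ?R" using D(3) by (auto intro!: inj_onI)
  then have 1: "(\<Sum>p\<in>Domain ?R. of_bool (fst p = i)) = (\<Sum>c\<in>?R. of_bool (fst (fst c) = i) :: int)"
    by (simp add: Domain_fst sum.reindex)
  have "inj_on snd ?R" using D(4) by (auto intro!: inj_onI)
  then have 2: "(\<Sum>p\<in>Range ?R. of_bool (fst p = i)) = (\<Sum>c\<in>?R. of_bool (fst (snd c) = i) :: int)"
    by (simp add: Range_snd sum.reindex)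
  have sub: "Domain ?R \<subseteq> crossing_points D" "Range ?R \<subseteq> crossing_points D"
    by (auto simp: crossing_points_def)
  have restrict: "(\<Sum>p\<in>{p \<in> crossing_points D. fst p = i}. of_bool (p \<in> A))
      = (\<Sum>p\<in>A. of_bool (fst p = i) :: int)" if "A \<subseteq> crossing_points D" for A
  proof -
    have "finite A" using that fin by (rule finite_subset)
    then show ?thesis using that fin
      by (simp add: sum.If_cases of_bool_def Int_def) (metis (lifting) subsetD)
  qed
  have "(\<Sum>p\<in>{p \<in> crossing_points D. fst p = i}. crossing_weight D p)
      = (\<Sum>p\<in>Domain ?R. of_bool (fst p = i)) - (\<Sum>p\<in>Range ?R. of_bool (fst p = i))"
    by (simp add: crossing_weight_def sum_subtractf restrict sub)
  then show ?thesis by (simp add: crossing_index_def 1 2 sum_subtractf case_prod_unfold)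
qed

section \<open>The height function on the universal cover of a component\<close>

locale diagram_component =
  fixes D :: diagram and i :: nat
  assumes diagram: "virtual_link_diagram D" and comp: "i < ncomps D"
begin

definition pt :: "real \<Rightarrow> point" where "pt t = (i, cis t)"

definition noncrossing :: "point set" where
  "noncrossing = source D - crossing_points D"

text \<open>Open at \<open>a\<close> and closed at \<open>b\<close>: adjacent intervals are then
  disjoint, and a crossing is counted on arrival, which makes \<open>height\<close> continuous from
  the right.\<close>

definition angles_between :: "real \<Rightarrow> real \<Rightarrow> real set" where
  "angles_between a b = {u \<in> {a<..b}. pt u \<in> crossing_points D}"

definition jump :: "real \<Rightarrow> real \<Rightarrow> int" where
  "jump a b = (\<Sum>u\<in>angles_between a b. crossing_weight D (pt u))"

text \<open>
  A primitive of the crossing weights on the universal cover; one of the two jumps vanishes,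
  according to the sign of \<open>t\<close>.
\<close>

definition height :: "real \<Rightarrow> int" where
  "height t = jump 0 t - jump t 0"

lemma semi_arcs_eq: "semi_arcs D = components noncrossing"
  by (simp add: semi_arcs_def noncrossing_def crossing_points_def)

lemma pt_in_source [simp]: "pt t \<in> source D"
  using comp by (simp add: pt_def source_def)

lemma pt_noncrossing_iff: "pt t \<in> noncrossing \<longleftrightarrow> pt t \<notin> crossing_points D"
  by (simp add: noncrossing_def)

lemma finite_angles_between: "finite (angles_between a b)"
proof -
  have "angles_between a b \<subseteq> (\<Union>p\<in>crossing_points D. {u \<in> {a..b}. cis u = snd p})"
    by (force simp: angles_between_def pt_def)
  then show ?thesis
    using finite_crossing_points[OF diagram] finite_cis_preimage
    by (meson finite_UN finite_subset)
qed

lemma jump_add: "a \<le> b \<Longrightarrow> b \<le> c \<Longrightarrow> jump a c = jump a b + jump b c"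
proof -
  assume "a \<le> b" "b \<le> c"
  then have "angles_between a c = angles_between a b \<union> angles_between b c"
    "angles_between a b \<inter> angles_between b c = {}"
    by (auto simp: angles_between_def)
  then show ?thesis by (simp add: jump_def sum.union_disjoint finite_angles_between)
qed

lemma jump_reverse: "b \<le> a \<Longrightarrow> jump a b = 0"
  by (simp add: jump_def angles_between_def)

lemma height_diff: "a \<le> b \<Longrightarrow> height b - height a = jump a b"
  unfolding height_def
  \<comment> \<open>The three instances are the positions of 0: before both angles, after both, and
    between them.\<close>
  using jump_add[of 0 a b] jump_add[of a b 0] jump_add[of a 0 b]
    jump_reverse[of 0 a] jump_reverse[of 0 b] jump_reverse[of a 0] jump_reverse[of b 0]
  by linarith

text \<open>A half-open period is mapped bijectively onto the circle, so one turn meets every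
  crossing point of the component exactly once.\<close>

lemma jump_full_turn: "jump a (a + 2 * pi) = crossing_index (real_crossings D) i"
proof -
  have "bij_betw cis (angles_between a (a + 2 * pi)) {z \<in> sphere 0 1. (i, z) \<in> crossing_points D}"
    unfolding angles_between_def pt_def
    using bij_betw_cis[of a] by (rule bij_betw_Collect) simp
  moreover have "bij_betw (Pair i) {z \<in> sphere 0 1. (i, z) \<in> crossing_points D}
      {p \<in> crossing_points D. fst p = i}"
  proof -
    have "crossing_points D \<subseteq> source D"
      using virtual_link_diagramD(2)[OF diagram] by (auto simp: crossing_points_def)
    then show ?thesis
      by (auto intro!: bij_betwI[of _ _ _ snd] simp: source_def)
  qed
  ultimately have "bij_betw (Pair i \<circ> cis) (angles_between a (a + 2 * pi))
      {p \<in> crossing_points D. fst p = i}"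
    by (rule bij_betw_trans)
  then have "bij_betw pt (angles_between a (a + 2 * pi)) {p \<in> crossing_points D. fst p = i}"
    by (simp add: pt_def[abs_def] comp_def)
  then show ?thesis
    unfolding jump_def crossing_index_eq_sum_weight[OF diagram]
    by (rule sum.reindex_bij_betw)
qed

text \<open>The monodromy of \<open>height\<close>: it descends to the circle modulo
  \<open>n\<close> as soon as \<open>n\<close> divides the crossing index.\<close>

lemma height_full_turns:
  "height (t + 2 * pi * of_int k) = height t + k * crossing_index (real_crossings D) i"
proof -
  have step: "height (t + 2 * pi) = height t + crossing_index (real_crossings D) i" for t
    using height_diff[of t "t + 2 * pi"] jump_full_turn[of t] by simp
  show ?thesis
  proof (induction k rule: int_induct[where k = 0])
    case (step1 k)
    have "height (t + 2 * pi * of_int (k + 1)) = height ((t + 2 * pi * of_int k) + 2 * pi)"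
      by (simp add: algebra_simps)
    then show ?case using step1 step[of "t + 2 * pi * of_int k"] by (simp add: algebra_simps)
  next
    case (step2 k)
    have "height (t + 2 * pi * of_int k) = height ((t + 2 * pi * of_int (k - 1)) + 2 * pi)"
      by (simp add: algebra_simps)
    then show ?case using step2 step[of "t + 2 * pi * of_int (k - 1)"] by (simp add: algebra_simps)
  qed simp
qed

lemma isolated_angle:
  obtains e where "e > 0" "\<And>u. u \<noteq> x \<Longrightarrow> \<bar>u - x\<bar> < e \<Longrightarrow> pt u \<notin> crossing_points D"
proof -
  obtain d where d: "d > 0" "\<And>u. u \<in> angles_between (x - 1) (x + 1) \<Longrightarrow> u \<noteq> x \<Longrightarrow> d \<le> dist x u"
    using finite_set_avoid[OF finite_angles_between[of "x - 1" "x + 1"], of x] by blast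
  show thesis
  \<comment> \<open>The bound 1 keeps \<open>u\<close> in the window in which \<open>d\<close> was
    found.\<close>
  proof (rule that[of "min d 1"])
    fix u assume "u \<noteq> x" "\<bar>u - x\<bar> < min d 1"
    then show "pt u \<notin> crossing_points D"
      using d(2)[of u] by (auto simp: angles_between_def dist_real_def abs_less_iff)
  qed (use d in auto)
qed

text \<open>Near \<open>x\<close> only \<open>x\<close> itself can carry a crossing, so
  \<open>height\<close> is a step function there, with its value at \<open>x\<close> already
  including the step. The formula also covers an ordinary point \<open>x\<close>, whose weight is
  0.\<close>

lemma height_near:
  assumes e: "\<And>u. u \<noteq> x \<Longrightarrow> \<bar>u - x\<bar> < e \<Longrightarrow> pt u \<notin> crossing_points D" and y: "\<bar>y - x\<bar> < e"
  shows "height y = height x - (if y < x then crossing_weight D (pt x) else 0)"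
proof (cases "y < x")
  case True
  have "angles_between y x = (if pt x \<in> crossing_points D then {x} else {})"
  proof -
    have "pt u \<notin> crossing_points D" if "y < u" "u < x" for u
      using e[of u] that y by auto
    then show ?thesis using True by (force simp: angles_between_def)
  qed
  then have "jump y x = crossing_weight D (pt x)"
    by (auto simp: jump_def crossing_weight_def crossing_points_def)
  then show ?thesis using True height_diff[of y x] by simp
next
  case False
  have "angles_between x y = {}"
  proof -
    have "pt u \<notin> crossing_points D" if "x < u" "u \<le> y" for u
      using e[of u] that y by auto
    then show ?thesis by (auto simp: angles_between_def)
  qed
  then show ?thesis using False height_diff[of x y] by (simp add: jump_def)
qed

section \<open>Semi-arcs along a component\<close>

definition arc_of :: "real \<Rightarrow> point set" where
  "arc_of t = connected_component_set noncrossing (pt t)"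

lemma arc_of_in_semi_arcs: "pt t \<notin> crossing_points D \<Longrightarrow> arc_of t \<in> semi_arcs D"
  by (simp add: semi_arcs_eq arc_of_def componentsI pt_noncrossing_iff)

lemma pt_in_arc_of: "pt t \<notin> crossing_points D \<Longrightarrow> pt t \<in> arc_of t"
  by (simp add: arc_of_def pt_noncrossing_iff connected_component_refl_eq)

lemma arc_of_eq:
  assumes "\<And>u. a \<le> u \<Longrightarrow> u \<le> b \<Longrightarrow> pt u \<notin> crossing_points D" and "a \<le> b"
  shows "arc_of a = arc_of b"
proof -
  have "continuous_on {a..b} pt"
    unfolding pt_def[abs_def] by (intro continuous_intros)
  then have "connected (pt ` {a..b})" by (rule connected_continuous_image) simp
  moreover have "pt ` {a..b} \<subseteq> noncrossing" using assms by (auto simp: pt_noncrossing_iff)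
  moreover have "pt a \<in> pt ` {a..b}" "pt b \<in> pt ` {a..b}" using assms by auto
  ultimately have "connected_component noncrossing (pt a) (pt b)"
    unfolding connected_component_def by blast
  then have "pt b \<in> arc_of a" by (simp add: arc_of_def)
  then show ?thesis unfolding arc_of_def by (metis connected_component_eq)
qed

text \<open>Unlike \<open>arc_of\<close>, which is empty at a crossing, this is a semi-arc at every
  angle. Reading it just after \<open>x\<close> matches the right-continuity of
  \<open>height\<close>.\<close>

definition right_arc :: "real \<Rightarrow> point set" where
  "right_arc x = (SOME A. A \<in> semi_arcs D \<and> starts_at A (pt x))"

context
  fixes x e :: real
  assumes isolated: "\<And>u. u \<noteq> x \<Longrightarrow> \<bar>u - x\<bar> < e \<Longrightarrow> pt u \<notin> crossing_points D"
begin

lemma starts_at_arc_of: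
  assumes "x < y" "y < x + e"
  shows "starts_at (arc_of y) (pt x)"
proof -
  have "pt (x + t) \<in> arc_of y" if "0 < t" "t < e" for t
  proof -
    \<comment> \<open>The order of \<open>x + t\<close> and \<open>y\<close> is not known; the
      interval between them stays to the right of \<open>x\<close> in either case.\<close>
    have "arc_of (min (x + t) y) = arc_of (max (x + t) y)"
    proof (rule arc_of_eq)
      fix u assume "min (x + t) y \<le> u" "u \<le> max (x + t) y"
      then have "u \<noteq> x" "\<bar>u - x\<bar> < e" using that assms by linarith+
      then show "pt u \<notin> crossing_points D" by (rule isolated)
    qed simp
    then have "arc_of (x + t) = arc_of y" by (simp add: min_def max_def split: if_splits)
    moreover have "pt (x + t) \<notin> crossing_points D" using that by (intro isolated) auto
    ultimately show ?thesis using pt_in_arc_of by blast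
  qed
  moreover have "\<forall>\<^sub>F t in at_right 0. 0 < t \<and> t < e"
    using assms eventually_at_right_real[of 0 e] by simp
  ultimately show ?thesis
    unfolding starts_at_def by (auto simp: pt_def cis_mult elim!: eventually_mono)
qed

lemma ends_at_arc_of:
  assumes "y < x" "x < y + e"
  shows "ends_at (arc_of y) (pt x)"
proof -
  have "pt (x - t) \<in> arc_of y" if "0 < t" "t < e" for t
  proof -
    have "arc_of (min (x - t) y) = arc_of (max (x - t) y)"
    proof (rule arc_of_eq)
      fix u assume "min (x - t) y \<le> u" "u \<le> max (x - t) y"
      then have "u \<noteq> x" "\<bar>u - x\<bar> < e" using that assms by linarith+
      then show "pt u \<notin> crossing_points D" by (rule isolated)
    qed simp
    then have "arc_of (x - t) = arc_of y" by (simp add: min_def max_def split: if_splits)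
    moreover have "pt (x - t) \<notin> crossing_points D" using that by (intro isolated) auto
    ultimately show ?thesis using pt_in_arc_of by blast
  qed
  moreover have "\<forall>\<^sub>F t in at_right 0. 0 < t \<and> t < e"
    using assms eventually_at_right_real[of 0 e] by simp
  ultimately show ?thesis
    unfolding ends_at_def by (auto simp: pt_def cis_mult elim!: eventually_mono)
qed

end

text \<open>Both sets contain all points shortly after \<open>p\<close>, hence they meet, and
  components that meet coincide.\<close>

lemma starts_at_unique:
  assumes "A \<in> semi_arcs D" "B \<in> semi_arcs D" "starts_at A p" "starts_at B p"
  shows "A = B"
proof -
  have "\<forall>\<^sub>F t in at_right 0. (fst p, snd p * cis t) \<in> A \<inter> B"
    using assms(3,4) unfolding starts_at_def by eventually_elim auto
  then have "A \<inter> B \<noteq> {}" by (auto dest: eventually_happens)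
  then show ?thesis using assms(1,2) unfolding semi_arcs_eq by (metis components_nonoverlap)
qed

lemma right_arc_eq: "A \<in> semi_arcs D \<Longrightarrow> starts_at A (pt x) \<Longrightarrow> right_arc x = A"
  unfolding right_arc_def by (rule some_equality) (metis starts_at_unique)+

lemma right_arc_near:
  assumes "\<And>u. u \<noteq> x \<Longrightarrow> \<bar>u - x\<bar> < e \<Longrightarrow> pt u \<notin> crossing_points D" "x < y" "y < x + e"
  shows "right_arc x = arc_of y"
proof (rule right_arc_eq)
  show "arc_of y \<in> semi_arcs D" using assms by (intro arc_of_in_semi_arcs) auto
  show "starts_at (arc_of y) (pt x)" using assms by (rule starts_at_arc_of)
qed

lemma right_arc_noncrossing:
  assumes "pt x \<notin> crossing_points D"
  shows "right_arc x = arc_of x"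
proof -
  obtain e where e: "e > 0" "\<And>u. u \<noteq> x \<Longrightarrow> \<bar>u - x\<bar> < e \<Longrightarrow> pt u \<notin> crossing_points D"
    using isolated_angle[of x] by blast
  have "right_arc x = arc_of (x + e / 2)" using e by (intro right_arc_near[of x e]) auto
  also have "\<dots> = arc_of x"
  proof (rule arc_of_eq[symmetric])
    fix u assume "x \<le> u" "u \<le> x + e / 2"
    then show "pt u \<notin> crossing_points D" using e assms by (cases "u = x") auto
  qed (use e in simp)
  finally show ?thesis .
qed

lemma weight_noncrossing: "p \<notin> crossing_points D \<Longrightarrow> crossing_weight D p = 0"
  by (simp add: crossing_points_def crossing_weight_def)

lemma right_arc_in_semi_arcs: "right_arc x \<in> semi_arcs D"
  and starts_at_right_arc: "starts_at (right_arc x) (pt x)"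
proof -
  obtain e where e: "e > 0" "\<And>u. u \<noteq> x \<Longrightarrow> \<bar>u - x\<bar> < e \<Longrightarrow> pt u \<notin> crossing_points D"
    using isolated_angle[of x] by blast
  have *: "right_arc x = arc_of (x + e / 2)" using e by (intro right_arc_near[of x e]) auto
  show "right_arc x \<in> semi_arcs D" unfolding * using e by (intro arc_of_in_semi_arcs) auto
  show "starts_at (right_arc x) (pt x)" unfolding * using e by (intro starts_at_arc_of[of x e]) auto
qed

section \<open>Colorings and divisibility of the crossing indices\<close>

lemma coloring_jump:
  assumes C: "up_down_coloring n D C" and A: "A \<in> semi_arcs D" "ends_at A (pt x)"
    and B: "B \<in> semi_arcs D" "starts_at B (pt x)" and x: "pt x \<in> crossing_points D"
  shows "[C B = C A + crossing_weight D (pt x)] (mod int n)"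
proof -
  consider q where "(pt x, q) \<in> real_crossings D" | p where "(p, pt x) \<in> real_crossings D"
    using x by (auto simp: crossing_points_def)
  then show ?thesis
  proof cases
    case 1
    then have "crossing_weight D (pt x) = 1" by (rule crossing_weight_over[OF diagram])
    then show ?thesis using C A B 1 unfolding up_down_coloring_def by fastforce
  next
    case 2
    then have "crossing_weight D (pt x) = -1" by (rule crossing_weight_under[OF diagram])
    then show ?thesis using C A B 2 unfolding up_down_coloring_def by fastforce
  qed
qed

text \<open>The color of \<open>right_arc\<close> and \<open>height\<close> have the same local
  increments modulo \<open>n\<close>, hence the same increment over a full turn. The color returns
  to its start while \<open>height\<close> gains the crossing index.\<close>

lemma index_dvd_of_coloring:
  assumes C: "up_down_coloring n D C"
  shows "int n dvd crossing_index (real_crossings D) i"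
proof -
  define P where
    "P a b \<longleftrightarrow> [C (right_arc b) - C (right_arc a) = height b - height a] (mod int n)" for a b
  have "P 0 (2 * pi)"
  \<comment> \<open>Bisection: \<open>P\<close> can be chained and holds on all short intervals
    around each angle, so it holds on the full turn.\<close>
  proof (rule Bolzano[of 0 "2 * pi" P])
    fix a b c assume "P a b" "P b c"
    then show "P a c" unfolding P_def using cong_add by fastforce
  next
    fix x :: real
    obtain e where e: "e > 0" "\<And>u. u \<noteq> x \<Longrightarrow> \<bar>u - x\<bar> < e \<Longrightarrow> pt u \<notin> crossing_points D"
      using isolated_angle[of x] by blast
    have "P a b" if ab: "a \<le> x" "x \<le> b" "b - a < e" for a b
    proof -
      have b: "right_arc b = right_arc x"
      proof (cases "b = x")
        case False
        then have "right_arc x = arc_of b" using ab by (intro right_arc_near[of x e] e) auto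
        moreover have "right_arc b = arc_of b"
          using e(2)[of b] False ab by (intro right_arc_noncrossing) auto
        ultimately show ?thesis by simp
      qed simp
      have hb: "height b = height x" using height_near[of x e b] e ab by auto
      show ?thesis
      proof (cases "a = x")
        case True
        then show ?thesis by (simp add: P_def b hb)
      next
        case False
        then have a: "pt a \<notin> crossing_points D" "a < x" using e(2)[of a] ab by auto
        have ha: "height a = height x - crossing_weight D (pt x)"
          using height_near[of x e a] e ab a by auto
        have ra: "right_arc a = arc_of a" using a(1) by (rule right_arc_noncrossing)
        have "[C (right_arc x) = C (arc_of a) + crossing_weight D (pt x)] (mod int n)"
        proof (cases "pt x \<in> crossing_points D")
          case True
          have "ends_at (arc_of a) (pt x)" using ab a by (intro ends_at_arc_of[of x e] e(2)) auto
          then show ?thesis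
            using coloring_jump[OF C arc_of_in_semi_arcs[OF a(1)] _ right_arc_in_semi_arcs
                starts_at_right_arc True] by blast
        next
          case False
          have "arc_of a = arc_of x"
          proof (rule arc_of_eq)
            fix u assume "a \<le> u" "u \<le> x"
            then show "pt u \<notin> crossing_points D" using e(2)[of u] ab False by (cases "u = x") auto
          qed (use a in simp)
          then show ?thesis using False right_arc_noncrossing weight_noncrossing by simp
        qed
        then show ?thesis
          unfolding P_def b hb ha ra by (simp add: cong_iff_dvd_diff algebra_simps)
      qed
    qed
    then show "\<exists>d>0. \<forall>a b. a \<le> x \<and> x \<le> b \<and> b - a < d \<longrightarrow> P a b"
      using e(1) by blast
  qed simp
  \<comment> \<open>\<open>right_arc\<close> depends on the angle only through \<open>pt\<close>,
    which has period \<open>2 * pi\<close>.\<close>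
  moreover have "right_arc (2 * pi) = right_arc 0"
    by (simp add: right_arc_def pt_def)
  moreover have "height (2 * pi) - height 0 = crossing_index (real_crossings D) i"
    using height_diff[of 0 "2 * pi"] jump_full_turn[of 0] by simp
  ultimately show ?thesis by (simp add: P_def cong_iff_dvd_diff)
qed

text \<open>Divisibility makes \<open>height\<close> modulo \<open>n\<close> a function on the
  circle. It is locally constant away from the crossings, hence constant on the connected set
  \<open>A\<close>.\<close>

lemma height_constant_on_semi_arc:
  assumes n: "int n dvd crossing_index (real_crossings D) i"
    and A: "A \<in> semi_arcs D" and t: "pt t \<in> A" and p: "p \<in> A"
  shows "fst p = i" "[height (Arg (snd p)) = height t] (mod int n)"
proof -
  have conn: "connected A" and sub: "A \<subseteq> noncrossing"
    using A in_components_connected in_components_subset unfolding semi_arcs_eq by blast+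
  \<comment> \<open>A connected set cannot change component, since the component number is a
    continuous map to a discrete space.\<close>
  have fst_A: "fst b = i" if "b \<in> A" for b
  proof -
    have "fst (pt t) = fst b"
    proof (rule connected_local_const[OF conn t that], rule ballI)
      fix a :: point
      have "((\<lambda>b. fst b) \<longlongrightarrow> fst a) (at a within A)" by (intro tendsto_intros)
      then have "\<forall>\<^sub>F b in at a within A. fst b = fst a" unfolding tendsto_discrete .
      then show "\<forall>\<^sub>F b in at a within A. fst a = fst b" by eventually_elim simp
    qed
    then show ?thesis by (simp add: pt_def)
  qed
  then show "fst p = i" using p .
  have lift: "[height (Arg (cis s)) = height s] (mod int n)" for s
  proof -
    have "cis (Arg (cis s)) = cis s" by (simp add: cis_Arg sgn_eq)
    then obtain k :: int where "Arg (cis s) = s + 2 * pi * of_int k"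
      unfolding cis_eq_cis_iff by blast
    then show ?thesis using n by (simp add: height_full_turns cong_iff_dvd_diff)
  qed
  define f where "f p = height (Arg (snd p)) mod int n" for p :: point
  \<comment> \<open>\<open>Arg\<close> itself jumps at the negative real axis, so continuity is taken from \<open>Arg\<close> near \<open>1\<close>.\<close>
  have "f p = f (pt t)"
  proof (rule connected_local_const[where f = f, OF conn p t], rule ballI)
    fix a assume a: "a \<in> A"
    have norm_A: "norm (snd b) = 1" if "b \<in> A" for b
      using sub that by (auto simp: noncrossing_def source_def)
    define t0 where "t0 = Arg (snd a)"
    have z: "snd a = cis t0" "snd a \<noteq> 0"
      using norm_A[OF a] by (auto simp: t0_def cis_Arg_unit)
    then have pt_a: "a = pt t0" using fst_A[OF a] by (simp add: pt_def prod_eq_iff)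
    obtain e where e: "e > 0" "\<And>u. u \<noteq> t0 \<Longrightarrow> \<bar>u - t0\<bar> < e \<Longrightarrow> pt u \<notin> crossing_points D"
      using isolated_angle[of t0] by blast
    have "((\<lambda>b. Arg (snd b / snd a)) \<longlongrightarrow> Arg (snd a / snd a)) (at a within A)"
    proof (rule isCont_tendsto_compose[where g = Arg])
      show "isCont Arg (snd a / snd a)" using z by (intro continuous_at_Arg) auto
      show "((\<lambda>b. snd b / snd a) \<longlongrightarrow> snd a / snd a) (at a within A)"
        using z(2) by (intro tendsto_intros)
    qed
    then have "\<forall>\<^sub>F b in at a within A. \<bar>Arg (snd b / snd a)\<bar> < e"
      using tendstoD[OF _ e(1)] z by (fastforce simp: dist_real_def)
    moreover have "\<forall>\<^sub>F b in at a within A. b \<in> A" by (auto simp: eventually_at_filter)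
    ultimately show "\<forall>\<^sub>F b in at a within A. f a = f b"
    proof eventually_elim
      case (elim b)
      \<comment> \<open>\<open>d\<close> is the small angle from \<open>a\<close> to
        \<open>b\<close>, so \<open>t0 + d\<close> is a lift of \<open>b\<close> close to
        \<open>t0\<close>, even where \<open>Arg (snd b)\<close> is not.\<close>
      define d where "d = Arg (snd b / snd a)"
      have "snd b / snd a \<noteq> 0" "norm (snd b / snd a) = 1"
        using z norm_A[OF elim(2)] norm_A[OF a] by (auto simp: norm_divide)
      then have "cis d = snd b / snd a" unfolding d_def by (simp add: cis_Arg sgn_eq)
      then have b: "snd b = cis (t0 + d)" using z by (simp add: cis_mult[symmetric])
      have "pt t0 \<notin> crossing_points D" using a sub pt_a by (auto simp: noncrossing_def)
      then have "height (t0 + d) = height t0"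
        using height_near[of t0 e "t0 + d"] e(2) elim(1) by (simp add: d_def weight_noncrossing)
      then show "f a = f b"
        using lift[of t0] lift[of "t0 + d"] by (simp add: f_def z b cong_def)
    qed
  qed
  then show "[height (Arg (snd p)) = height t] (mod int n)"
    using lift[of t] by (simp add: f_def cong_def pt_def)
qed

text \<open>Turns the limiting conditions \<open>ends_at\<close> and \<open>starts_at\<close> into
  sample angles on a common lift, where \<open>height_near\<close> compares them.\<close>

lemma height_across_crossing:
  assumes A: "A \<in> semi_arcs D" "ends_at A (pt x)" and B: "B \<in> semi_arcs D" "starts_at B (pt x)"
  obtains a b where "pt a \<in> A" "pt b \<in> B" "height b = height a + crossing_weight D (pt x)"
proof -
  obtain e where e: "e > 0" "\<And>u. u \<noteq> x \<Longrightarrow> \<bar>u - x\<bar> < e \<Longrightarrow> pt u \<notin> crossing_points D"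
    using isolated_angle[of x] by blast
  have ev: "\<forall>\<^sub>F t in at_right (0::real). 0 < t \<and> t < e"
    using e eventually_at_right_real[of 0 e] by simp
  have "\<forall>\<^sub>F t in at_right 0. pt (x - t) \<in> A" "\<forall>\<^sub>F t in at_right 0. pt (x + t) \<in> B"
    using A(2) B(2) by (simp_all add: ends_at_def starts_at_def pt_def cis_mult)
  with ev have "\<forall>\<^sub>F t in at_right 0. pt (x - t) \<in> A \<and> pt (x + t) \<in> B \<and> 0 < t \<and> t < e"
    by eventually_elim auto
  then obtain t where t: "pt (x - t) \<in> A" "pt (x + t) \<in> B" "0 < t" "t < e"
    by (auto dest: eventually_happens)
  have "height (x + t) = height (x - t) + crossing_weight D (pt x)"
    using height_near[of x e "x + t"] height_near[of x e "x - t"] e(2) t by simp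
  then show thesis using that t by blast
qed

end

lemma coloring_of_index_dvd:
  assumes D: "virtual_link_diagram D" and n: "n > 0"
    and dvd: "\<And>i. i < ncomps D \<Longrightarrow> int n dvd crossing_index (real_crossings D) i"
  shows "up_down_colorable n D"
proof -
  \<comment> \<open>The color is the height modulo \<open>n\<close> at some point of the semi-arc;
    \<open>C_eq\<close> shows that neither the point nor its lift matters.\<close>
  define C :: "point set \<Rightarrow> int" where
    "C A = (let p = SOME p. p \<in> A in diagram_component.height D (fst p) (Arg (snd p)) mod int n)" for A
  have C_eq: "[C A = diagram_component.height D i t] (mod int n)"
    if "A \<in> semi_arcs D" "(i, cis t) \<in> A" "i < ncomps D" for A i t
  proof -
    interpret diagram_component D i using D that by unfold_locales
    have "(SOME p. p \<in> A) \<in> A" using that(2) by (rule someI)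
    then show ?thesis
      using height_constant_on_semi_arc[OF dvd[OF that(3)] that(1), of t "SOME p. p \<in> A"] that(2)
      by (simp add: C_def Let_def pt_def cong_def)
  qed
  \<comment> \<open>One congruence yields both coloring rules, as the weight is 1 at over-points and
    -1 at under-points.\<close>
  have weight: "[C B = C A + crossing_weight D p] (mod int n)"
    if p: "p \<in> source D" and AB: "A \<in> semi_arcs D" "B \<in> semi_arcs D" "ends_at A p" "starts_at B p"
    for A B p
  proof -
    obtain i z where iz: "p = (i, z)" "i < ncomps D" "norm z = 1"
      using p by (auto simp: source_def)
    interpret diagram_component D i using D iz by unfold_locales
    have "p = pt (Arg z)" using iz by (auto simp: pt_def cis_Arg_unit)
    then obtain a b where "pt a \<in> A" "pt b \<in> B" "height b = height a + crossing_weight D p"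
      using height_across_crossing[of A "Arg z" B] AB by auto
    then show ?thesis
      using C_eq[of A i a] C_eq[of B i b] AB iz(2)
      by (simp add: pt_def) (metis cong_add_rcancel cong_sym cong_trans)
  qed
  note R = virtual_link_diagramD[OF D]
  have "up_down_coloring n D C"
    unfolding up_down_coloring_def
  proof (intro conjI ballI, goal_cases)
    case 1
    then show ?case using n by (auto simp: C_def Let_def)
  next
    case (2 c)
    obtain p q where c: "c = (p, q)" by (rule prod.exhaust)
    have "p \<in> source D" "q \<in> source D" using R(2) 2 c by auto
    then show ?case using 2 c weight[of p] weight[of q] crossing_weight_over[OF D, of p q] crossing_weight_under[OF D, of p q] by simp
  qed
  then show ?thesis unfolding up_down_colorable_def by blast
qed

lemma up_down_colorable_iff:
  assumes "virtual_link_diagram D" "n > 0"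
  shows "up_down_colorable n D \<longleftrightarrow> (\<forall>i<ncomps D. int n dvd crossing_index (real_crossings D) i)"
  using assms coloring_of_index_dvd diagram_component.index_dvd_of_coloring
  unfolding up_down_colorable_def diagram_component_def by blast

section \<open>The maximum order of a diagram with two components\<close>

lemma crossing_index_two_components:
  assumes "virtual_link_diagram D" "ncomps D = 2"
  shows "crossing_index (real_crossings D) 1 = - crossing_index (real_crossings D) 0"
proof -
  have fst: "of_bool (fst p = 1) = (1 - of_bool (fst p = 0) :: int)" if "p \<in> source D" for p
    using that assms(2) by (auto simp: source_def less_2_cases_iff)
  have "of_bool (fst p = 1) - of_bool (fst q = 1) =
      - (of_bool (fst p = 0) - of_bool (fst q = 0) :: int)" if "(p, q) \<in> real_crossings D" for p q
    using virtual_link_diagramD(2)[OF assms(1) that] fst[of p] fst[of q] by simp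
  then show ?thesis
    unfolding crossing_index_def sum_negf[symmetric] by (intro sum.cong) auto
qed

lemma maxord_eq_index:
  assumes "virtual_link_diagram D" "ncomps D = 2"
  shows "maxord D = nat \<bar>crossing_index (real_crossings D) 0\<bar>"
proof -
  define d where "d = crossing_index (real_crossings D) 0"
  have "(\<forall>i<2. int n dvd crossing_index (real_crossings D) i) \<longleftrightarrow> int n dvd d" for n
    unfolding less_2_cases_iff
    using crossing_index_two_components[OF assms] by (auto simp: d_def)
  then have set: "{n. n > 0 \<and> up_down_colorable n D} = {n. n > 0 \<and> n dvd nat \<bar>d\<bar>}"
    using up_down_colorable_iff[OF assms(1)] assms(2) by (auto simp: int_dvd_int_iff[symmetric])
  show ?thesis
  proof (cases "d = 0")
    \<comment> \<open>Every positive \<open>n\<close> divides 0, so the set of orders is infinite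
      and the default value 0 of \<open>maxord\<close> agrees with the index.\<close>
    case True
    then have "{n. n > 0 \<and> up_down_colorable n D} = {0<..}" using set by auto
    then show ?thesis using True by (simp add: maxord_def infinite_Ioi d_def)
  next
    case False
    then have "finite {n. n > 0 \<and> n dvd nat \<bar>d\<bar>}"
      by (intro finite_subset[OF _ finite_divisors_nat[of "nat \<bar>d\<bar>"]]) auto
    moreover from this have "Max {n. n > 0 \<and> n dvd nat \<bar>d\<bar>} = nat \<bar>d\<bar>"
      using False by (intro Max_eqI) (auto intro!: dvd_imp_le)
    ultimately show ?thesis by (simp add: maxord_def set d_def)
  qed
qed

section \<open>Isotopies and reparametrizations\<close>

lemma crossing_index_map:
  assumes "inj_on (map_prod \<rho> \<rho>) R"
    and "\<And>p q. (p, q) \<in> R \<Longrightarrow> (fst (\<rho> p) = j \<longleftrightarrow> fst p = i) \<and> (fst (\<rho> q) = j \<longleftrightarrow> fst q = i)"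
  shows "crossing_index (map_prod \<rho> \<rho> ` R) j = crossing_index R i"
  unfolding crossing_index_def sum.reindex[OF assms(1)]
  by (rule sum.cong) (use assms(2) in auto)

text \<open>Injectivity keeps crossings from merging when a sum is reindexed. The permutation
  separates the circles; on one circle the lift is strictly increasing and gains exactly one turn
  per turn.\<close>

lemma reparametrization_inj_on:
  assumes "reparametrization k \<rho>"
  shows "inj_on \<rho> ({..<k} \<times> sphere 0 1)"
proof -
  obtain \<sigma> \<theta> where \<sigma>: "bij_betw \<sigma> {..<k} {..<k}"
    and mono: "\<And>i. i < k \<Longrightarrow> strict_mono (\<theta> i)"
    and period: "\<And>i t. i < k \<Longrightarrow> \<theta> i (t + 2 * pi) = \<theta> i t + 2 * pi"
    and \<rho>: "\<And>i t. i < k \<Longrightarrow> \<rho> (i, cis t) = (\<sigma> i, cis (\<theta> i t :: real))"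
    using assms unfolding reparametrization_def by metis
  have angle: "\<exists>t\<in>{0<..2 * pi}. z = cis t" if "z \<in> sphere 0 1" for z
    using bij_betw_cis[of 0] that by (auto simp: bij_betw_def)
  have inj: "cis s = cis t"
    if st: "s \<in> {0<..2 * pi}" "t \<in> {0<..2 * pi}" "s \<le> t" and i: "i < k"
      and eq: "cis (\<theta> i s) = cis (\<theta> i t)" for s t i
  proof -
    \<comment> \<open>The half-open period makes this strict, so the lifted angles lie less than a
      turn apart, where \<open>cis\<close> is injective.\<close>
    have "t < s + 2 * pi" using st by simp
    then have "\<theta> i t < \<theta> i s + 2 * pi"
      using strict_monoD[OF mono[OF i]] period[OF i] by metis
    moreover have "\<theta> i s \<le> \<theta> i t"
      using mono[OF i] st(3) by (simp add: strict_mono_less_eq)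
    ultimately have "\<theta> i s \<in> {\<theta> i t - 2 * pi<..\<theta> i t}" "\<theta> i t \<in> {\<theta> i t - 2 * pi<..\<theta> i t}"
      by auto
    then have "\<theta> i s = \<theta> i t"
      using bij_betw_cis[of "\<theta> i t - 2 * pi"] eq by (auto simp: bij_betw_def dest: inj_onD)
    then show ?thesis using strict_mono_eq[OF mono[OF i]] by simp
  qed
  show ?thesis
  proof (rule inj_onI)
    fix p q assume pq: "p \<in> {..<k} \<times> sphere 0 1" "q \<in> {..<k} \<times> sphere 0 1" "\<rho> p = \<rho> q"
    obtain i s where p: "p = (i, cis s)" "i < k" "s \<in> {0<..2 * pi}"
      using pq(1) angle by fastforce
    obtain j t where q: "q = (j, cis t)" "j < k" "t \<in> {0<..2 * pi}"
      using pq(2) angle by fastforce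
    have "\<sigma> i = \<sigma> j" "cis (\<theta> i s) = cis (\<theta> j t)" using pq(3) \<rho> p q by auto
    then have "i = j" using \<sigma> p q by (auto simp: bij_betw_def dest: inj_onD)
    then show "p = q"
      using inj[of s t i] inj[of t s i] \<open>cis (\<theta> i s) = cis (\<theta> j t)\<close> p q by (metis linear)
  qed
qed

text \<open>The reparametrization carries the crossings over with their roles and acts on component
  numbers by \<open>\<sigma>\<close>, so it only permutes the indices.\<close>

lemma isotopy_crossing_index:
  assumes "isotopic_diagrams D D'" "virtual_link_diagram D"
  obtains \<sigma> where "bij_betw \<sigma> {..<ncomps D} {..<ncomps D}"
    "\<And>i. i < ncomps D \<Longrightarrow>
      crossing_index (real_crossings D') (\<sigma> i) = crossing_index (real_crossings D) i"
proof -
  obtain \<rho> where rep: "reparametrization (ncomps D) \<rho>"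
    and R: "real_crossings D' = map_prod \<rho> \<rho> ` real_crossings D"
    using assms(1) unfolding isotopic_diagrams_def by blast
  obtain \<sigma> \<theta> where \<sigma>: "bij_betw \<sigma> {..<ncomps D} {..<ncomps D}"
    and \<rho>: "\<And>i t. i < ncomps D \<Longrightarrow> \<rho> (i, cis t) = (\<sigma> i, cis (\<theta> i t :: real))"
    using rep unfolding reparametrization_def by metis
  have source: "p \<in> source D" "q \<in> source D" if "(p, q) \<in> real_crossings D" for p q
    using virtual_link_diagramD(2)[OF assms(2) that] by auto
  have fst_\<rho>: "fst (\<rho> p) = \<sigma> (fst p)" "fst p < ncomps D" if p: "p \<in> source D" for p
  proof -
    have "norm (snd p) = 1" and 1: "fst p < ncomps D" using p by (auto simp: source_def)
    then have "p = (fst p, cis (Arg (snd p)))" by (simp add: cis_Arg_unit)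
    then show "fst (\<rho> p) = \<sigma> (fst p)" using \<rho>[OF 1] by (metis fst_conv)
    show "fst p < ncomps D" using 1 .
  qed
  have "inj_on \<rho> (source D)"
    using reparametrization_inj_on[OF rep] by (simp add: source_def)
  then have "inj_on (map_prod \<rho> \<rho>) (source D \<times> source D)"
    by (simp add: map_prod_inj_on)
  then have inj: "inj_on (map_prod \<rho> \<rho>) (real_crossings D)"
    by (rule inj_on_subset) (use source in auto)
  have "crossing_index (real_crossings D') (\<sigma> i) = crossing_index (real_crossings D) i"
    if i: "i < ncomps D" for i
  proof -
    have "fst (\<rho> p) = \<sigma> i \<longleftrightarrow> fst p = i" if "p \<in> source D" for p
      using fst_\<rho>[OF that] i \<sigma> by (auto simp: bij_betw_def dest: inj_onD)
    then show ?thesis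
      unfolding R using source by (intro crossing_index_map[OF inj]) blast
  qed
  then show thesis using that \<sigma> by blast
qed

section \<open>Changes of the crossing index inside a disk\<close>

lemma crossing_index_split:
  assumes "virtual_link_diagram D"
  shows "crossing_index (real_crossings D) i =
    crossing_index {(p, q) \<in> real_crossings D. curve D p \<notin> B} i
      + crossing_index (real_crossings_in B D) i"
proof -
  have "real_crossings D = {(p, q) \<in> real_crossings D. curve D p \<notin> B} \<union> real_crossings_in B D"
    "{(p, q) \<in> real_crossings D. curve D p \<notin> B} \<inter> real_crossings_in B D = {}"
    by (auto simp: real_crossings_in_def)
  then show ?thesis
    using virtual_link_diagramD(1)[OF assms] unfolding crossing_index_def
    by (metis (no_types, lifting) finite_Un sum.union_disjoint)
qed

text \<open>The crossings outside the disk are the same for both diagrams, so their contributions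
  cancel.\<close>

lemma local_change_crossing_index:
  assumes "local_change B as D D'" "virtual_link_diagram D" "virtual_link_diagram D'"
  shows "crossing_index (real_crossings D') i - crossing_index (real_crossings D) i =
    crossing_index (real_crossings_in B D') i - crossing_index (real_crossings_in B D) i"
  using assms crossing_index_split[of D i B] crossing_index_split[of D' i B]
  by (simp add: local_change_def)

lemma real_crossings_in_empty:
  assumes "virtual_link_diagram D" "double_points_in B D = {}"
  shows "real_crossings_in B D = {}"
proof -
  have "real_crossings D \<subseteq> double_points D" using assms(1) by (simp add: virtual_link_diagram_def)
  then show ?thesis using assms(2) unfolding double_points_in_def real_crossings_in_def by blast
qed

lemma fst_point_at [simp]: "fst (point_at a t) = fst a"
  by (simp add: point_at_def split: prod.split)

text \<open>The over-point and the under-point of the new crossing lie on the same strand, so their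
  contributions cancel.\<close>

lemma adds_kink_crossing_index:
  assumes "adds_kink rl D D'" "virtual_link_diagram D" "virtual_link_diagram D'"
  shows "crossing_index (real_crossings D') i = crossing_index (real_crossings D) i"
proof -
  obtain B a t u where lc: "local_change B [a] D D'" and D: "double_points_in B D = {}"
    and D': "real_crossings_in B D' = (if rl then {(point_at a t, point_at a u)} else {})"
    using assms(1) unfolding adds_kink_def by blast
  then show ?thesis
    using local_change_crossing_index[OF lc assms(2,3), of i] real_crossings_in_empty[OF assms(2) D]
    by (simp add: crossing_index_def split: if_splits)
qed

text \<open>Each real-crossing contributes -1, 0 or 1 to the index of a component, and at most two
  are added.\<close>

lemma adds_bigon_crossing_index:
  assumes "adds_bigon rl D D'" "virtual_link_diagram D" "virtual_link_diagram D'"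
  shows "\<bar>crossing_index (real_crossings D') i - crossing_index (real_crossings D) i\<bar>
    \<le> 2 * of_bool rl"
proof -
  obtain B a b t t' u u' where lc: "local_change B [a, b] D D'" and D: "double_points_in B D = {}"
    and D': "real_crossings_in B D' =
      (if rl then {(point_at a t, point_at b u), (point_at a t', point_at b u')} else {})"
    using assms(1) unfolding adds_bigon_def by blast
  have "\<bar>crossing_index {(point_at a t, point_at b u), (point_at a t', point_at b u')} i\<bar> \<le> 2"
    \<comment> \<open>The sum over the set has one term or two according to whether the pairs
      coincide.\<close>
    by (cases "(point_at a t, point_at b u) = (point_at a t', point_at b u')")
      (simp_all add: crossing_index_def)
  then show ?thesis
    using local_change_crossing_index[OF lc assms(2,3), of i] real_crossings_in_empty[OF assms(2) D] D'
    by (simp add: crossing_index_def split: if_splits)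
qed

text \<open>The right-hand side depends on the pattern \<open>R\<close> and the components of the
  strands but not on the positions \<open>x\<close>, so it is the same before and after the
  move.\<close>

lemma triangle_crossing_index:
  assumes tri: "triangle R B as x D" and strands: "strands_in B as D" and len: "length as = 3"
    and R: "R \<subseteq> {(j, l). j < 3 \<and> l < 3 \<and> j \<noteq> l}"
  shows "crossing_index (real_crossings_in B D) i =
    (\<Sum>(j, l)\<in>R. of_bool (fst (as ! j) = i) - of_bool (fst (as ! l) = i))"
proof -
  let ?P = "\<lambda>j l. point_at (as ! j) (x j l)"
  let ?S = "\<lambda>j. point_at (as ! j) ` angles (as ! j)"
  have inner: "?P j l \<in> ?S j" if "j < 3" "l < 3" "j \<noteq> l" for j l
  proof -
    have "x j l \<in> inner_angles (as ! j)" using tri that unfolding triangle_def by blast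
    then have "x j l \<in> angles (as ! j)"
      by (auto simp: inner_angles_def angles_def split: prod.splits)
    then show ?thesis by blast
  qed
  have disj: "?S j \<inter> ?S j' = {}" if "j < 3" "j' < 3" "j \<noteq> j'" for j j'
    using strands that len unfolding strands_in_def disjoint_family_on_def by simp
  \<comment> \<open>The strands are disjoint in the source, so a crossing point determines its
    strand; distinct pairs in \<open>R\<close> thus give distinct crossings.\<close>
  have same: "j = j'" if "?P j l = ?P j' l'" "j < 3" "l < 3" "j \<noteq> l" "j' < 3" "l' < 3" "j' \<noteq> l'"
    for j l j' l'
    using inner[of j l] inner[of j' l'] disj[of j j'] that by (metis IntI empty_iff)
  have inj: "inj_on (\<lambda>(j, l). (?P j l, ?P l j)) R"
  proof (rule inj_onI, clarify)
    fix j l j' l' assume "(j, l) \<in> R" "(j', l') \<in> R" and eq: "?P j l = ?P j' l'" "?P l j = ?P l' j'"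
    then have "j < 3" "l < 3" "j \<noteq> l" "j' < 3" "l' < 3" "j' \<noteq> l'" using R by auto
    then show "j = j' \<and> l = l'" using same[OF eq(1)] same[OF eq(2)] by auto
  qed
  have "real_crossings_in B D = (\<lambda>(j, l). (?P j l, ?P l j)) ` R"
    using tri unfolding triangle_def by auto
  then show ?thesis
    unfolding crossing_index_def by (simp only: sum.reindex[OF inj]) (simp add: case_prod_unfold comp_def)
qed

lemma moves_across_crossing_index:
  assumes "moves_across R D D'" "R \<subseteq> {(j, l). j < 3 \<and> l < 3 \<and> j \<noteq> l}"
    and "virtual_link_diagram D" "virtual_link_diagram D'"
  shows "crossing_index (real_crossings D') i = crossing_index (real_crossings D) i"
proof -
  obtain B as x x' where len: "length as = 3" and lc: "local_change B as D D'"
    and tri: "triangle R B as x D" "triangle R B as x' D'"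
    using assms(1) unfolding moves_across_def by blast
  have "strands_in B as D" "strands_in B as D'" using lc by (simp_all add: local_change_def)
  then show ?thesis
    using local_change_crossing_index[OF lc assms(3,4), of i]
      triangle_crossing_index[OF tri(1) _ len assms(2), of i]
      triangle_crossing_index[OF tri(2) _ len assms(2), of i] by simp
qed

section \<open>Counting RII-moves\<close>

lemma changes_ncomps: "changes m D D' \<Longrightarrow> ncomps D' = ncomps D"
  by (cases m) (auto simp: isotopic_diagrams_def adds_kink_def adds_bigon_def moves_across_def
      local_change_def)

lemma changes_maxord:
  assumes m: "changes m D D'" and D: "virtual_link_diagram D" "virtual_link_diagram D'"
    and two: "ncomps D = 2"
  shows "\<bar>int (maxord D') - int (maxord D)\<bar> \<le> 2 * of_bool (m = RII)"
proof -
  let ?d = "crossing_index (real_crossings D)" and ?d' = "crossing_index (real_crossings D')"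
  have two': "ncomps D' = 2" using changes_ncomps[OF m] two by simp
  have "\<bar>\<bar>?d' 0\<bar> - \<bar>?d 0\<bar>\<bar> \<le> 2 * of_bool (m = RII)"
  proof (cases "m = Isotopy")
    case True
    then have iso: "isotopic_diagrams D D'" using m by simp
    obtain \<sigma> where "bij_betw \<sigma> {..<2} {..<2}" "\<And>i. i < 2 \<Longrightarrow> ?d' (\<sigma> i) = ?d i"
      using isotopy_crossing_index[OF iso D(1)] two by metis
    then have "\<sigma> 0 < 2" "?d' (\<sigma> 0) = ?d 0" by (auto simp: bij_betw_def)
    \<comment> \<open>If \<open>\<sigma>\<close> swaps the components, the index changes sign, which
      the absolute value absorbs.\<close>
    then have "\<bar>?d' 0\<bar> = \<bar>?d 0\<bar>"
      using crossing_index_two_components[OF D(2) two'] by (auto simp: less_2_cases_iff)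
    then show ?thesis by simp
  next
    case False
    \<comment> \<open>These moves keep the numbering of the components, so index 0 can be compared
      directly; the reverse triangle inequality then passes to absolute values.\<close>
    then have "\<bar>?d' 0 - ?d 0\<bar> \<le> 2 * of_bool (m = RII)"
      using m adds_kink_crossing_index[OF _ D] adds_bigon_crossing_index[OF _ D]
        moves_across_crossing_index[OF _ _ D]
      by (cases m) fastforce+
    then show ?thesis by linarith
  qed
  then show ?thesis by (simp add: maxord_eq_index[OF D(1) two] maxord_eq_index[OF D(2) two'])
qed

text \<open>A move may be made in either direction; the bound is symmetric in the two
  diagrams.\<close>

lemma related_by_maxord:
  assumes "related_by m D D'" "ncomps D = 2"
  shows "ncomps D' = 2" "\<bar>int (maxord D') - int (maxord D)\<bar> \<le> 2 * of_bool (m = RII)"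
  using assms changes_ncomps[of m D D'] changes_ncomps[of m D' D]
    changes_maxord[of m D D'] changes_maxord[of m D' D]
  by (auto simp: related_by_def abs_minus_commute)

text \<open>Triangle inequality along the sequence; every intermediate diagram still has two
  components, so the bound for a single move applies to each step.\<close>

lemma move_sequence_maxord:
  assumes "move_sequence D ms D'" "ncomps D = 2"
  shows "\<bar>int (maxord D') - int (maxord D)\<bar> \<le> 2 * int (count_list ms RII)"
  using assms
proof (induction ms arbitrary: D)
  case (Cons m ms)
  then obtain E where E: "related_by m D E" "move_sequence E ms D'" by auto
  note step = related_by_maxord[OF E(1) Cons.prems(2)]
  show ?case using Cons.IH[OF E(2) step(1)] step(2) by (auto split: if_splits)
qed simp

theorem theorem1p2:
  fixes D D' :: diagram and ms :: "move list"
  assumes "virtual_link_diagram D" and "virtual_link_diagram D'"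
    and "ncomps D = 2" and "ncomps D' = 2"
    and "same_virtual_link D D'"
    and "move_sequence D ms D'"
  shows "real (count_list ms RII) \<ge> \<bar>real (maxord D) - real (maxord D')\<bar> / 2"
proof -
  have "\<bar>int (maxord D') - int (maxord D)\<bar> \<le> 2 * int (count_list ms RII)"
    using assms by (intro move_sequence_maxord)
  then have "\<bar>real (maxord D) - real (maxord D')\<bar> \<le> 2 * real (count_list ms RII)"
    by linarith
  then show ?thesis by simp
qed

end
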